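(* For all integers $n>1$, the proportion of sequences $A\in\mathcal{B}_n$ satisfying $$\mu(A) > \sqrt{2n\big(\log n - \log\log n + 0.862\big)}$$ is strictly less than $1$.
   Context: A binary sequence of length $n$ is an $n$-tuple $A = (a_0, a_1, \ldots, a_{n-1})$ with each $a_j \in \{+1,-1\}$. $\mathcal{B}_n$ denotes the set of all $2^n$ binary sequences of length $n$. For $0 \le k \le n-1$, the (aperiodic) autocorrelations of $A$ are $c_k = \sum_{j=0}^{n-k-1} a_j a_{j+k}$. For $n \ge 2$, the peak sidelobe level of $A$ is $\mu(A) = \max_{1\le k\le n-1} |c_k|$. The proportion of sequences $A \in \mathcal{B}_n$ with a given property is the number of such sequences divided by $2^n$. Here $\log$ denotes the natural logarithm, and $0.862$ is the exact decimal constant $862/1000$. *)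

theory Defs
  imports Complex_Main "HOL-Library.FuncSet"
begin

text \<open>A sequence of length \<open>n\<close> is an extensional function on the index set \<open>{0..<n}\<close>,
  so each tuple has exactly one representative.\<close>

definition binary_seqs :: "nat \<Rightarrow> (nat \<Rightarrow> int) set" where
  "binary_seqs n = {0..<n} \<rightarrow>\<^sub>E {1, -1}"

definition autocorr :: "nat \<Rightarrow> (nat \<Rightarrow> int) \<Rightarrow> nat \<Rightarrow> int" where
  "autocorr n A k = (\<Sum>j\<in>{0..<n - k}. A j * A (j + k))"

text \<open>Only meaningful for \<open>n \<ge> 2\<close>; otherwise the maximum is over the empty set.\<close>

definition peak_sidelobe :: "nat \<Rightarrow> (nat \<Rightarrow> int) \<Rightarrow> int" where
  "peak_sidelobe n A = Max ((\<lambda>k. \<bar>autocorr n A k\<bar>) ` {1..n - 1})"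

definition proportion :: "nat \<Rightarrow> ((nat \<Rightarrow> int) \<Rightarrow> bool) \<Rightarrow> real" where
  "proportion n P = real (card {A \<in> binary_seqs n. P A}) / 2 ^ n"

end

theory Submission
  imports Defs
begin

text \<open>
  The proof is a union bound over the shifts. For a uniformly random sequence the \<open>n - k\<close> products
  \<open>A j * A (j + k)\<close> that make up \<open>autocorr n A k\<close> behave like independent random signs, although
  they share entries of \<open>A\<close>: conditioned on the earlier entries, the last entry turns the last
  product into a fair sign. Hence the exponential moment of \<open>autocorr n A k\<close> is
  exactly \<open>cosh s ^ (n - k)\<close> (lemma \<open>sum_exp_autocorr\<close>), and \<open>cosh s \<le> exp (s\<^sup>2 / 2)\<close> gives the
  sub-Gaussian tail bound of lemma \<open>card_large_autocorr\<close>,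
  \<open>2 * exp (- t\<^sup>2 / (2 * (n - k)))\<close> for the proportion of sequences with
  \<open>\<bar>autocorr n A k\<bar> > t\<close>.

  Put \<open>t\<^sup>2 = 2 * n * L\<close>. Since \<open>n / (n - k) \<ge> 1 + k / n\<close>, the tail bounds are dominated by a geometric
  progression in \<open>k\<close> with ratio \<open>exp (- L / n)\<close>, whose sum is less than \<open>2 * exp (- L) * n / L\<close>.
  The gain of the factor \<open>L\<close> over the trivial estimate \<open>2 * n * exp (- L)\<close>
  is what permits the term \<open>- ln (ln n)\<close> in \<open>L\<close>. For
  \<open>L = x - ln x + c\<close> with \<open>x = ln n\<close> the total is \<open>2 * exp (- c) * x / L\<close>. The
  quotient \<open>L / x\<close> is smallest at \<open>x = exp (1 + c)\<close>, with value \<open>1 - exp (- c - 1)\<close>; so the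
  total is at most \<open>1\<close> for every \<open>n\<close> as soon as \<open>exp c \<ge> 2 + exp (- 1)\<close>. The
  least such \<open>c\<close> is \<open>0.861994\<dots>\<close>, which explains the constant \<open>0.862\<close>.
\<close>

section \<open>Exponential moments of an autocorrelation\<close>

lemma finite_binary_seqs: "finite (binary_seqs n)"
  by (simp add: binary_seqs_def finite_PiE)

lemma card_binary_seqs: "card (binary_seqs n) = 2 ^ n"
  by (simp add: binary_seqs_def card_PiE flip: numeral_2_eq_2)

lemma sum_binary_seqs_Suc:
  fixes f :: "(nat \<Rightarrow> int) \<Rightarrow> real"
  shows "(\<Sum>A\<in>binary_seqs (Suc n). f A) =
    (\<Sum>A\<in>binary_seqs n. f (A(n := 1)) + f (A(n := - 1)))"
proof -
  let ?app = "\<lambda>(y, A). A(n := y)"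
  have eq: "binary_seqs (Suc n) = ?app ` ({1, - 1} \<times> binary_seqs n)"
    by (simp add: binary_seqs_def atLeast0_lessThan_Suc PiE_insert_eq)
  have "inj_on ?app ({1, - 1} \<times> binary_seqs n)"
    unfolding binary_seqs_def by (rule inj_combinator) simp
  then have "(\<Sum>A\<in>binary_seqs (Suc n). f A) =
      (\<Sum>p\<in>{1, - 1} \<times> binary_seqs n. f (?app p))"
    unfolding eq by (simp add: sum.reindex)
  also have "\<dots> = (\<Sum>y\<in>{1, - 1}. \<Sum>A\<in>binary_seqs n. f (A(n := y)))"
    by (simp add: sum.cartesian_product case_prod_beta)
  also have "\<dots> = (\<Sum>A\<in>binary_seqs n. f (A(n := 1)) + f (A(n := - 1)))"
    by (simp add: sum.distrib)
  finally show ?thesis .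
qed

lemma autocorr_snoc:
  assumes "1 \<le> k" "k \<le> n"
  shows "autocorr (Suc n) (A(n := y)) k = autocorr n A k + A (n - k) * y"
proof -
  have *: "{0..<Suc n - k} = insert (n - k) {0..<n - k}"
    using assms by (auto simp: Suc_diff_le)
  have "(\<Sum>j\<in>{0..<n - k}. (A(n := y)) j * (A(n := y)) (j + k)) = (\<Sum>j\<in>{0..<n - k}. A j * A (j + k))"
    using assms by (intro sum.cong) auto
  moreover have "n - k \<noteq> n"
    using assms by simp
  ultimately show ?thesis
    unfolding autocorr_def * using assms by (simp add: add.commute)
qed

text \<open>
  The final entry occurs in the single product \<open>A (n - k) * A n\<close>, so summing over its two values
  replaces that product by a fair sign whatever the rest of the sequence is. This contributes one
  factor \<open>2 * cosh s\<close> for each entry beyond the first \<open>k\<close>.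
\<close>

lemma sum_exp_autocorr:
  assumes "1 \<le> k" "k \<le> n"
  shows "(\<Sum>A\<in>binary_seqs n. exp (s * real_of_int (autocorr n A k))) = 2 ^ n * cosh s ^ (n - k)"
  using assms(2)
proof (induction n rule: dec_induct)
  case base
  then show ?case by (simp add: autocorr_def card_binary_seqs)
next
  case (step n)
  let ?E = "\<lambda>A. exp (s * real_of_int (autocorr n A k))"
  have fair: "exp (s * real_of_int (autocorr (Suc n) (A(n := 1)) k)) +
      exp (s * real_of_int (autocorr (Suc n) (A(n := - 1)) k)) = 2 * cosh s * ?E A"
    if "A \<in> binary_seqs n" for A
  proof -
    have "n - k \<in> {0..<n}"
      using assms(1) step.hyps by auto
    then have "A (n - k) \<in> {1, - 1}"
      using that unfolding binary_seqs_def by (rule PiE_mem[rotated])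
    then show ?thesis
      using assms(1) step.hyps
      by (auto simp: autocorr_snoc cosh_def algebra_simps simp flip: exp_add)
  qed
  have "(\<Sum>A\<in>binary_seqs (Suc n). exp (s * real_of_int (autocorr (Suc n) A k))) =
      (\<Sum>A\<in>binary_seqs n. 2 * cosh s * ?E A)"
    unfolding sum_binary_seqs_Suc by (rule sum.cong) (simp_all add: fair)
  also have "\<dots> = 2 * cosh s * (2 ^ n * cosh s ^ (n - k))"
    by (simp only: sum_distrib_left[symmetric] step.IH)
  also have "\<dots> = 2 ^ Suc n * cosh s ^ (Suc n - k)"
    using step.hyps by (simp add: Suc_diff_le)
  finally show ?case .
qed

section \<open>Sub-Gaussian tails\<close>

lemma two_power_fact_le: "2 ^ k * fact k \<le> (fact (2 * k) :: real)"
proof (induction k)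
  case (Suc k)
  have "2 ^ Suc k * fact (Suc k) = (2 * (real k + 1)) * (2 ^ k * fact k)"
    by (simp add: algebra_simps)
  also have "\<dots> \<le> ((2 * real k + 2) * (2 * real k + 1)) * fact (2 * k)"
    using Suc by (intro mult_mono) (auto simp: algebra_simps)
  also have "\<dots> = fact (2 * Suc k)"
    by (simp add: algebra_simps)
  finally show ?case .
qed simp

text \<open>
  Compare the power series in \<open>s\<^sup>2\<close> term by term: their coefficients are \<open>1 / fact (2 * k)\<close> and
  \<open>1 / (2 ^ k * fact k)\<close>.
\<close>

lemma cosh_le_exp_half_square: "cosh (s::real) \<le> exp (s\<^sup>2 / 2)"
proof (rule sums_le)
  have "(\<lambda>n. if even n then s ^ n /\<^sub>R fact n else 0) sums cosh s"
    by (rule cosh_converges)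
  then have "(\<lambda>k. (\<lambda>n. if even n then s ^ n /\<^sub>R fact n else 0) (2 * k)) sums cosh s"
    by (subst sums_mono_reindex) (auto simp: strict_mono_def elim!: evenE)
  then show "(\<lambda>k. s ^ (2 * k) / fact (2 * k)) sums cosh s"
    by (simp add: field_simps)
  show "(\<lambda>k. (s\<^sup>2 / 2) ^ k /\<^sub>R fact k) sums exp (s\<^sup>2 / 2)"
    by (rule exp_converges)
  show "s ^ (2 * k) / fact (2 * k) \<le> (s\<^sup>2 / 2) ^ k /\<^sub>R fact k" for k
  proof -
    have "s ^ (2 * k) / fact (2 * k) \<le> s ^ (2 * k) / (2 ^ k * fact k)"
      using two_power_fact_le[of k] by (intro divide_left_mono) auto
    also have "\<dots> = (s\<^sup>2 / 2) ^ k /\<^sub>R fact k"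
      unfolding power_mult[of s 2 k] power_divide real_scaleR_def by (simp only: divide_simps) simp
    finally show ?thesis .
  qed
qed

text \<open>
  This is Chernoff's method: both tails are bounded by an exponential moment, at the parameter
  \<open>s = t / (n - k)\<close>, which minimises \<open>(n - k) * s\<^sup>2 / 2 - s * t\<close>.
\<close>

lemma card_large_autocorr:
  assumes "1 \<le> k" "k < n" "0 \<le> t"
  shows "real (card {A \<in> binary_seqs n. real_of_int \<bar>autocorr n A k\<bar> > t})
    \<le> 2 ^ n * (2 * exp (- (t\<^sup>2 / (2 * real (n - k)))))"
proof -
  let ?c = "\<lambda>A. real_of_int (autocorr n A k)"
  let ?B = "{A \<in> binary_seqs n. real_of_int \<bar>autocorr n A k\<bar> > t}"
  define m where "m = n - k"
  have m: "m > 0" using assms by (simp add: m_def)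
  define s where "s = t / real m"
  have s: "s \<ge> 0" using assms by (simp add: s_def)
  have "real (card ?B) * exp (s * t) = (\<Sum>A\<in>?B. exp (s * t))"
    by simp
  also have "\<dots> \<le> (\<Sum>A\<in>?B. exp (s * ?c A) + exp (- s * ?c A))"
  proof (rule sum_mono)
    fix A assume "A \<in> ?B"
    then have "t \<le> \<bar>?c A\<bar>" by simp
    then have "s * t \<le> s * \<bar>?c A\<bar>" by (rule mult_left_mono) (rule s)
    then have "exp (s * t) \<le> exp (s * \<bar>?c A\<bar>)" by simp
    also have "\<dots> \<le> exp (s * ?c A) + exp (- s * ?c A)"
      by (cases "?c A \<ge> 0") auto
    finally show "exp (s * t) \<le> exp (s * ?c A) + exp (- s * ?c A)" .
  qed
  also have "\<dots> \<le> (\<Sum>A\<in>binary_seqs n. exp (s * ?c A) + exp (- s * ?c A))"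
    by (rule sum_mono2) (auto intro: finite_binary_seqs add_nonneg_nonneg)
  also have "\<dots> = 2 ^ n * (2 * cosh s ^ m)"
    using assms sum_exp_autocorr[of k n s] sum_exp_autocorr[of k n "- s"]
    by (simp add: sum.distrib m_def)
  also have "\<dots> \<le> 2 ^ n * (2 * exp (s\<^sup>2 / 2) ^ m)"
    by (intro mult_left_mono power_mono cosh_le_exp_half_square) auto
  also have "exp (s\<^sup>2 / 2) ^ m = exp (- (t\<^sup>2 / (2 * real m))) * exp (s * t)"
    using m by (simp add: s_def power2_eq_square field_simps flip: exp_of_nat_mult exp_add)
  finally have "real (card ?B) * exp (s * t)
      \<le> (2 ^ n * (2 * exp (- (t\<^sup>2 / (2 * real m))))) * exp (s * t)"
    by (simp add: mult.assoc)
  then show ?thesis by (simp add: m_def)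
qed

section \<open>Analytic estimates\<close>

lemma sum_exp_geometric_less:
  assumes "(y::real) > 0"
  shows "(\<Sum>k\<in>{1..n - 1}. exp (- y * real k)) < 1 / y"
proof -
  define q where "q = exp (- y)"
  have q: "0 < q" "q < 1" using assms by (auto simp: q_def)
  have S: "(\<Sum>k\<in>{1..m}. q ^ k) * (1 - q) = q - q ^ Suc m" for m
  proof (induction m)
    case (Suc m)
    have "(\<Sum>k\<in>{1..Suc m}. q ^ k) * (1 - q) =
        (\<Sum>k\<in>{1..m}. q ^ k) * (1 - q) + q ^ Suc m * (1 - q)"
      by (simp add: distrib_right)
    also have "\<dots> = q - q ^ Suc (Suc m)"
      unfolding Suc.IH by (simp add: algebra_simps)
    finally show ?case .
  qed simp
  have "q * (1 + y) \<le> q * exp y"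
    using q by (intro mult_left_mono) auto
  also have "q * exp y = 1" by (simp add: q_def flip: exp_add)
  finally have qy: "q * y \<le> 1 - q" by (simp add: algebra_simps)
  have "(\<Sum>k\<in>{1..n - 1}. q ^ k) * (1 - q) < q"
    using S[of "n - 1"] q by simp
  also have "q \<le> (1 / y) * (1 - q)"
    using qy assms by (simp add: field_simps)
  finally have "(\<Sum>k\<in>{1..n - 1}. q ^ k) < 1 / y"
    by (rule mult_right_less_imp_less) (use q in simp)
  moreover have "exp (- y * real k) = q ^ k" for k
    by (simp add: q_def mult.commute flip: exp_of_nat_mult)
  ultimately show ?thesis by simp
qed

lemma exp_ge_partial_sum: "x \<ge> 0 \<Longrightarrow> (\<Sum>k<N. x ^ k / fact k) \<le> exp (x::real)"
  using sum_le_suminf[OF summable_exp_generic[of x], of "{..<N}"]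
  by (simp add: exp_def divide_inverse mult.commute)

text \<open>
  The two sides, \<open>2.367879\<dots>\<close> and \<open>2.367891\<dots>\<close>, differ by little more than \<open>10\<close> millionths;
  ten terms of each exponential series resolve that difference.
\<close>

lemma exp_0862_ge: "2 + exp (- 1) \<le> exp (862 / 1000 :: real)"
proof -
  have "(\<Sum>k<10. (1::real) ^ k / fact k) \<le> exp 1"
    by (rule exp_ge_partial_sum) simp
  then have "271828 / 100000 \<le> exp (1::real)"
    by (simp add: lessThan_nat_numeral fact_numeral)
  then have "exp (- 1 :: real) \<le> 100000 / 271828"
    by (simp add: exp_minus field_simps)
  moreover have "(\<Sum>k<10. (862 / 1000 :: real) ^ k / fact k) \<le> exp (862 / 1000)"
    by (rule exp_ge_partial_sum) simp
  then have "2 + 100000 / 271828 \<le> exp (862 / 1000 :: real)"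
    by (simp add: lessThan_nat_numeral fact_numeral power_divide)
  ultimately show ?thesis by linarith
qed

text \<open>
  The tangent to \<open>ln\<close> at the minimiser \<open>exp (1 + c)\<close> of \<open>(x - ln x + c) / x\<close> lies above \<open>ln\<close>.
\<close>

lemma ratio_le_of_exp_ge:
  assumes "x > 0" "2 + exp (- 1) \<le> exp c"
  shows "2 * exp (- c) * x \<le> x - ln x + (c::real)"
proof -
  have "ln (x * exp (- c - 1)) \<le> x * exp (- c - 1) - 1"
    using assms by (intro ln_le_minus_one) auto
  then have tangent: "ln x \<le> x * exp (- c - 1) + c"
    using assms by (simp add: ln_mult)
  have "(2 + exp (- 1)) * exp (- c) \<le> exp c * exp (- c)"
    using assms by (intro mult_right_mono) auto
  moreover have "(2 + exp (- 1)) * exp (- c) = 2 * exp (- c) + exp (- c - 1)"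
    using exp_add[of "- c" "- 1"] by (simp add: distrib_left mult.commute)
  ultimately have "2 * exp (- c) + exp (- c - 1) \<le> 1"
    by (simp flip: exp_add)
  then have "(2 * exp (- c) + exp (- c - 1)) * x \<le> 1 * x"
    using assms by (intro mult_right_mono) auto
  with tangent show ?thesis by (simp add: algebra_simps)
qed

section \<open>The union bound over all shifts\<close>

lemma proportion_peak_sidelobe_le:
  assumes "n > 1" "0 \<le> t"
  shows "proportion n (\<lambda>A. real_of_int (peak_sidelobe n A) > t)
    \<le> (\<Sum>k\<in>{1..n - 1}. 2 * exp (- (t\<^sup>2 / (2 * real (n - k)))))"
proof -
  let ?B = "\<lambda>k. {A \<in> binary_seqs n. real_of_int \<bar>autocorr n A k\<bar> > t}"
  have "{A \<in> binary_seqs n. real_of_int (peak_sidelobe n A) > t} \<subseteq> (\<Union>k\<in>{1..n - 1}. ?B k)"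
  proof
    fix A assume A: "A \<in> {A \<in> binary_seqs n. real_of_int (peak_sidelobe n A) > t}"
    have "peak_sidelobe n A \<in> (\<lambda>k. \<bar>autocorr n A k\<bar>) ` {1..n - 1}"
      unfolding peak_sidelobe_def using assms by (intro Max_in) auto
    with A show "A \<in> (\<Union>k\<in>{1..n - 1}. ?B k)" by auto
  qed
  then have "card {A \<in> binary_seqs n. real_of_int (peak_sidelobe n A) > t}
      \<le> card (\<Union>k\<in>{1..n - 1}. ?B k)"
    by (intro card_mono) (auto simp: finite_binary_seqs)
  also have "\<dots> \<le> (\<Sum>k\<in>{1..n - 1}. card (?B k))"
    by (rule card_UN_le) simp
  finally have "real (card {A \<in> binary_seqs n. real_of_int (peak_sidelobe n A) > t})
      \<le> (\<Sum>k\<in>{1..n - 1}. real (card (?B k)))"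
    by (simp flip: of_nat_sum)
  also have "\<dots> \<le> (\<Sum>k\<in>{1..n - 1}. 2 ^ n * (2 * exp (- (t\<^sup>2 / (2 * real (n - k))))))"
    using assms by (intro sum_mono card_large_autocorr) auto
  also have "\<dots> = 2 ^ n * (\<Sum>k\<in>{1..n - 1}. 2 * exp (- (t\<^sup>2 / (2 * real (n - k)))))"
    by (rule sum_distrib_left[symmetric])
  finally show ?thesis
    by (simp add: proportion_def divide_le_eq mult.commute)
qed

text \<open>
  Replacing \<open>n / (n - k)\<close> by its linear lower bound \<open>1 + k / n\<close> costs little because the tails are
  negligible unless \<open>k\<close> is small compared with \<open>n\<close>.
\<close>

lemma proportion_peak_sidelobe_less:
  assumes "n > 1" "0 < L"
  shows "proportion n (\<lambda>A. real_of_int (peak_sidelobe n A) > sqrt (2 * real n * L))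
    < 2 * exp (- L) * (real n / L)"
proof -
  have "proportion n (\<lambda>A. real_of_int (peak_sidelobe n A) > sqrt (2 * real n * L))
      \<le> (\<Sum>k\<in>{1..n - 1}. 2 * exp (- ((sqrt (2 * real n * L))\<^sup>2 / (2 * real (n - k)))))"
    using assms by (intro proportion_peak_sidelobe_le) auto
  also have "\<dots> \<le> (\<Sum>k\<in>{1..n - 1}. 2 * exp (- L) * exp (- (L / real n) * real k))"
  proof (rule sum_mono)
    fix k assume k: "k \<in> {1..n - 1}"
    then have "(1 + real k / real n) * real (n - k) \<le> real n"
      using assms by (auto simp: of_nat_diff field_simps)
    then have "1 + real k / real n \<le> real n / real (n - k)"
      using k assms by (subst pos_le_divide_eq) auto
    then have "L * (1 + real k / real n) \<le> L * (real n / real (n - k))"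
      using assms by (intro mult_left_mono) auto
    then have "- ((sqrt (2 * real n * L))\<^sup>2 / (2 * real (n - k))) \<le> - L + - (L / real n) * real k"
      using assms by (simp add: algebra_simps)
    then show "2 * exp (- ((sqrt (2 * real n * L))\<^sup>2 / (2 * real (n - k))))
        \<le> 2 * exp (- L) * exp (- (L / real n) * real k)"
      by (simp flip: exp_add)
  qed
  also have "\<dots> = 2 * exp (- L) * (\<Sum>k\<in>{1..n - 1}. exp (- (L / real n) * real k))"
    by (rule sum_distrib_left[symmetric])
  also have "\<dots> < 2 * exp (- L) * (1 / (L / real n))"
    using assms by (intro mult_strict_left_mono sum_exp_geometric_less) auto
  finally show ?thesis by simp
qed

theorem corollary4:
  fixes n :: nat
  assumes "n > 1"
  shows "proportion n (\<lambda>A. real_of_int (peak_sidelobe n A)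
           > sqrt (2 * real n * (ln (real n) - ln (ln (real n)) + 862 / 1000))) < 1"
proof -
  define x where "x = ln (real n)"
  define c :: real where "c = 862 / 1000"
  define L where "L = x - ln x + c"
  have x: "x > 0" using assms by (simp add: x_def)
  have main: "2 * exp (- c) * x \<le> L"
    unfolding L_def using x exp_0862_ge by (intro ratio_le_of_exp_ge) (simp_all add: c_def)
  have L: "L > 0"
    using main x by (meson exp_gt_zero less_le_trans mult_pos_pos zero_less_numeral)
  have "exp (- L) = exp (- c) * exp (ln x) * exp (- x)"
    by (simp add: L_def flip: exp_add)
  then have "exp (- L) * real n = exp (- c) * x"
    using x assms by (simp add: x_def exp_minus)
  then have "2 * exp (- L) * (real n / L) \<le> 1"
    using main L by (simp add: field_simps)
  with proportion_peak_sidelobe_less[OF assms L] show ?thesis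
    by (simp add: L_def x_def c_def)
qed

end
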